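(* Consider an optimal trajectory $(x,u)$ of the affine optimal control problem (P) together with its lift $p$ given by Pontryagin's Maximum Principle, written in augmented notation. Along a singular arc one has $\langle p,f\rangle=0$.
   Context: Problem (P): minimize $\int_0^{T_f(u)} \big(f_0(x)+\sum_{i=1}^m g_{0i}(x)u_i\big)\,dt$ subject to $\dot x=f(x)+\sum_{i=1}^m g_i(x)u_i$, $x(0)=\mathcal A$, $x(T_f(u))=\mathcal B$ (given points of $\mathbb R^n$), where $u=(u_1,\dots,u_m):[0,T_f(u)]\to\mathbb R^m$ is measurable with $|u_i(t)|\le K(t)$ for all $t$ and $i$. The final time is free; $f,g_i$ are analytic vector fields on $\mathbb R^n$; $f_0,g_{0i}:\mathbb R^n\to\mathbb R$ are analytic; $K$ is analytic and strictly positive. Maximum Principle lift. Put $H_\lambda(x,p,u)=\langle p,f(x)+\sum_i g_i(x)u_i\rangle-\lambda\big(f_0(x)+\sum_i g_{0i}(x)u_i\big)$, $\lambda\in\{0,1\}$. Every optimal trajectory $(x,u)$ is considered with a lift $p(t)$ and $\lambda\in\{0,1\}$ such that $(\lambda,p(t))\ne0$ and, for almost all $t$, $\dot x=\partial H_\lambda/\partial p$, $\dot p=-\partial H_\lambda/\partial x$, $H_\lambda(x(t),p(t),u(t))=\max\{H_\lambda(x(t),p(t),w): |w_i|\le K(t)\}$, and $H_\lambda(x(t),p(t),u(t))=0$. Augmented notation. Add the coordinate $x_0$ with $\dot x_0=f_0(x)+\sum_i g_{0i}(x)u_i$, and write $f,g_i,x,p$ for the augmented objects $(f_0,f)$, $(g_{0i},g_i)$,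 $(x_0,x)$, $(-\lambda,p)$ in dimension $n+1$, so that $H_\lambda=\langle p,f\rangle+\sum_i\langle p,g_i\rangle u_i$. In the claim, $f$ and $p$ are these augmented objects. A singular arc is the restriction of the trajectory to an interval on which $\langle p(t),g_i(x(t))\rangle$ vanishes (augmented notation) for every $i=1,\dots,m$. *)

theory Defs
  imports "HOL-Analysis.Analysis"
begin

text \<open>Real analyticity in several variables: near each point of the set the function is the sum of
  an (unconditionally convergent) power series in the coordinates. The multi-indices are the
  functions from the basis to the naturals, made unique by extensionality outside the basis.
  As with \<open>analytic_on\<close>, the expansion holds on a full neighbourhood of each point of the set.\<close>

definition real_analytic_on :: "('a::euclidean_space \<Rightarrow> 'b::euclidean_space) \<Rightarrow> 'a set \<Rightarrow> bool"
  where
  "real_analytic_on f S \<longleftrightarrow>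
     (\<forall>a\<in>S. \<exists>r>0. \<exists>c :: ('a \<Rightarrow> nat) \<Rightarrow> 'b. \<forall>x\<in>ball a r.
        ((\<lambda>\<alpha>. (\<Prod>b\<in>Basis. ((x - a) \<bullet> b) ^ \<alpha> b) *\<^sub>R c \<alpha>) has_sum f x) (Basis \<rightarrow>\<^sub>E UNIV))"

text \<open>The library's \<open>absolutely_continuous\<close> is about measures; this is the notion for functions.\<close>

definition abs_continuous_on :: "real set \<Rightarrow> (real \<Rightarrow> 'a::real_normed_vector) \<Rightarrow> bool" where
  "abs_continuous_on S f \<longleftrightarrow>
     (\<forall>\<epsilon>>0. \<exists>\<delta>>0. \<forall>(N::nat) a b.
        (\<forall>i<N. a i \<le> b i \<and> {a i..b i} \<subseteq> S) \<longrightarrow>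
        (\<forall>i<N. \<forall>j<N. i \<noteq> j \<longrightarrow> {a i<..<b i} \<inter> {a j<..<b j} = {}) \<longrightarrow>
        (\<Sum>i<N. b i - a i) < \<delta> \<longrightarrow>
        (\<Sum>i<N. norm (f (b i) - f (a i))) < \<epsilon>)"

text \<open>The fields are, in order, \<open>f\<close>, \<open>g\<^sub>i\<close>, \<open>f\<^sub>0\<close>, \<open>g\<^sub>0\<^sub>i\<close>, \<open>K\<close> and the points \<open>\<A>\<close>, \<open>\<B>\<close>.\<close>

record ('n::finite, 'm::finite) affine_problem =
  drift :: "real^'n \<Rightarrow> real^'n"
  ctrl :: "'m \<Rightarrow> real^'n \<Rightarrow> real^'n"
  cost_drift :: "real^'n \<Rightarrow> real"
  cost_ctrl :: "'m \<Rightarrow> real^'n \<Rightarrow> real"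
  bnd :: "real \<Rightarrow> real"
  start :: "real^'n"
  target :: "real^'n"

definition analytic_problem :: "('n::finite, 'm::finite) affine_problem \<Rightarrow> bool" where
  "analytic_problem P \<longleftrightarrow>
     real_analytic_on (drift P) UNIV \<and> (\<forall>i. real_analytic_on (ctrl P i) UNIV) \<and>
     real_analytic_on (cost_drift P) UNIV \<and> (\<forall>i. real_analytic_on (cost_ctrl P i) UNIV) \<and>
     real_analytic_on (bnd P) {0..} \<and> (\<forall>t\<ge>0. bnd P t > 0)"

definition dynamics :: "('n::finite, 'm::finite) affine_problem \<Rightarrow> real^'n \<Rightarrow> real^'m \<Rightarrow> real^'n"
  where
  "dynamics P x u = drift P x + (\<Sum>i\<in>UNIV. u $ i *\<^sub>R ctrl P i x)"

definition running_cost :: "('n::finite, 'm::finite) affine_problem \<Rightarrow> real^'n \<Rightarrow> real^'m \<Rightarrow> real"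
  where
  "running_cost P x u = cost_drift P x + (\<Sum>i\<in>UNIV. cost_ctrl P i x * u $ i)"

definition control_value :: "('n::finite, 'm::finite) affine_problem \<Rightarrow> real \<Rightarrow> real^'m \<Rightarrow> bool"
  where
  "control_value P t w \<longleftrightarrow> (\<forall>i. \<bar>w $ i\<bar> \<le> bnd P t)"

text \<open>Trajectories are Caratheodory solutions on \<open>[0, T]\<close>; the final time \<open>T > 0\<close> is free.\<close>

definition admissible_trajectory ::
  "('n::finite, 'm::finite) affine_problem \<Rightarrow> real \<Rightarrow> (real \<Rightarrow> real^'n) \<Rightarrow> (real \<Rightarrow> real^'m) \<Rightarrow> bool"
  where
  "admissible_trajectory P T x u \<longleftrightarrow>
     T > 0 \<and>
     u \<in> borel_measurable (lebesgue_on {0..T}) \<and>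
     (\<forall>t\<in>{0..T}. control_value P t (u t)) \<and>
     abs_continuous_on {0..T} x \<and>
     (AE t in lebesgue_on {0..T}.
        (x has_vector_derivative dynamics P (x t) (u t)) (at t within {0..T})) \<and>
     x 0 = start P \<and> x T = target P"

definition total_cost ::
  "('n::finite, 'm::finite) affine_problem \<Rightarrow> real \<Rightarrow> (real \<Rightarrow> real^'n) \<Rightarrow> (real \<Rightarrow> real^'m) \<Rightarrow> real"
  where
  "total_cost P T x u = (LINT t|lebesgue_on {0..T}. running_cost P (x t) (u t))"

definition optimal_trajectory ::
  "('n::finite, 'm::finite) affine_problem \<Rightarrow> real \<Rightarrow> (real \<Rightarrow> real^'n) \<Rightarrow> (real \<Rightarrow> real^'m) \<Rightarrow> bool"
  where
  "optimal_trajectory P T x u \<longleftrightarrow>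
     admissible_trajectory P T x u \<and>
     (\<forall>T' x' u'. admissible_trajectory P T' x' u' \<longrightarrow> total_cost P T x u \<le> total_cost P T' x' u')"

definition hamiltonian ::
  "('n::finite, 'm::finite) affine_problem \<Rightarrow> real \<Rightarrow> real^'n \<Rightarrow> real^'n \<Rightarrow> real^'m \<Rightarrow> real"
  where
  "hamiltonian P lam x p u = p \<bullet> dynamics P x u - lam * running_cost P x u"

definition pmp_lift ::
  "('n::finite, 'm::finite) affine_problem \<Rightarrow> real \<Rightarrow> (real \<Rightarrow> real^'n) \<Rightarrow> (real \<Rightarrow> real^'m) \<Rightarrow>
     real \<Rightarrow> (real \<Rightarrow> real^'n) \<Rightarrow> bool"
  where
  "pmp_lift P T x u lam p \<longleftrightarrow>
     lam \<in> {0, 1} \<and>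
     abs_continuous_on {0..T} p \<and>
     (\<forall>t\<in>{0..T}. (lam, p t) \<noteq> 0) \<and>
     (AE t in lebesgue_on {0..T}.
        (\<exists>D. (GDERIV (\<lambda>q. hamiltonian P lam (x t) q (u t)) (p t) :> D) \<and>
             (x has_vector_derivative D) (at t within {0..T})) \<and>
        (\<exists>D. (GDERIV (\<lambda>y. hamiltonian P lam y (p t) (u t)) (x t) :> D) \<and>
             (p has_vector_derivative - D) (at t within {0..T})) \<and>
        is_arg_max (hamiltonian P lam (x t) (p t)) (control_value P t) (u t) \<and>
        hamiltonian P lam (x t) (p t) (u t) = 0)"

text \<open>Augmented objects live in \<open>real \<times> (real^'n)\<close>, the real component being the cost coordinate,
  whose additive constant is left free.\<close>

definition cost_coordinate ::
  "('n::finite, 'm::finite) affine_problem \<Rightarrow> real \<Rightarrow> (real \<Rightarrow> real^'n) \<Rightarrow> (real \<Rightarrow> real^'m) \<Rightarrow>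
     (real \<Rightarrow> real) \<Rightarrow> bool"
  where
  "cost_coordinate P T x u x0 \<longleftrightarrow>
     abs_continuous_on {0..T} x0 \<and>
     (AE t in lebesgue_on {0..T}.
        (x0 has_real_derivative running_cost P (x t) (u t)) (at t within {0..T}))"

definition aug_drift :: "('n::finite, 'm::finite) affine_problem \<Rightarrow> real \<times> (real^'n) \<Rightarrow> real \<times> (real^'n)"
  where
  "aug_drift P X = (cost_drift P (snd X), drift P (snd X))"

definition aug_ctrl ::
  "('n::finite, 'm::finite) affine_problem \<Rightarrow> 'm \<Rightarrow> real \<times> (real^'n) \<Rightarrow> real \<times> (real^'n)"
  where
  "aug_ctrl P i X = (cost_ctrl P i (snd X), ctrl P i (snd X))"

definition aug_state :: "(real \<Rightarrow> real) \<Rightarrow> (real \<Rightarrow> real^'n) \<Rightarrow> real \<Rightarrow> real \<times> (real^'n)" where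
  "aug_state x0 x t = (x0 t, x t)"

definition aug_costate :: "real \<Rightarrow> (real \<Rightarrow> real^'n) \<Rightarrow> real \<Rightarrow> real \<times> (real^'n)" where
  "aug_costate lam p t = (- lam, p t)"

lemma hamiltonian_augmented:
  "hamiltonian P lam (x t) (p t) w =
     aug_costate lam p t \<bullet> aug_drift P (aug_state x0 x t) +
     (\<Sum>i\<in>UNIV. (aug_costate lam p t \<bullet> aug_ctrl P i (aug_state x0 x t)) * w $ i)"
  by (simp add: hamiltonian_def dynamics_def running_cost_def aug_costate_def aug_drift_def
      aug_ctrl_def aug_state_def inner_add_right inner_sum_right sum_distrib_left sum_subtractf
      algebra_simps)

definition singular_arc ::
  "('n::finite, 'm::finite) affine_problem \<Rightarrow> real \<Rightarrow> (real \<Rightarrow> real \<times> (real^'n)) \<Rightarrow>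
     (real \<Rightarrow> real \<times> (real^'n)) \<Rightarrow> real set \<Rightarrow> bool"
  where
  "singular_arc P T X q I \<longleftrightarrow>
     is_interval I \<and> I \<subseteq> {0..T} \<and> (\<forall>t\<in>I. \<forall>i. q t \<bullet> aug_ctrl P i (X t) = 0)"

end

theory Submission
  imports Defs
begin

text \<open>Off a null set, the vanishing of the Hamiltonian and the bound \<open>\<bar>u\<^sub>i\<bar> \<le> K\<close> give
  \<open>\<bar>\<langle>p, f\<rangle>\<bar> \<le> K \<Sum>\<^sub>i \<bar>\<langle>p, g\<^sub>i\<rangle>\<bar>\<close>. Both sides are continuous in time, so the inequality holds at
  every time, and its right-hand side vanishes on a singular arc. In particular the arc may
  degenerate to a single point.\<close>

text \<open>In one real coordinate, unconditional and absolute summability agree. Finitely many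
  coordinates then give a summable l1 norm, which dominates \<open>norm\<close>.\<close>

lemma summable_on_imp_abs_summable_on_euclidean:
  fixes f :: "'i \<Rightarrow> 'a::euclidean_space"
  assumes "f summable_on A"
  shows "(\<lambda>i. norm (f i)) summable_on A"
proof (rule Infinite_Sum.abs_summable_on_comparison_test')
  have inner: "(\<lambda>i. \<bar>f i \<bullet> b\<bar>) summable_on A" for b
  proof -
    have "(\<lambda>i. f i \<bullet> b) summable_on A"
      using summable_on_bounded_linear[OF bounded_linear_inner_left assms] by (simp add: o_def)
    then show ?thesis
      using summable_on_iff_abs_summable_on_real by force
  qed
  have "(\<lambda>i. \<Sum>b\<in>B. \<bar>f i \<bullet> b\<bar>) summable_on A" if "finite B" for B
    using that by (induction B) (auto intro: summable_on_add inner)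
  then show "(\<lambda>i. \<Sum>b\<in>Basis. \<bar>f i \<bullet> b\<bar>) summable_on A"
    by simp
  show "norm (f i) \<le> (\<Sum>b\<in>Basis. \<bar>f i \<bullet> b\<bar>)" for i
    by (rule norm_le_l1)
qed

text \<open>Weierstrass M-test on a cube around \<open>a\<close>: the partial sums are polynomials,
  and convergence at one corner of the cube supplies the majorant for the whole cube.\<close>

lemma real_analytic_on_imp_continuous_at:
  assumes "real_analytic_on f S" "a \<in> S"
  shows "continuous (at a) f"
proof -
  define e where "e = (\<lambda>x \<alpha>. \<Prod>b\<in>Basis. ((x - a) \<bullet> b) ^ \<alpha> b)"
  define J :: "('a \<Rightarrow> nat) set" where "J = Basis \<rightarrow>\<^sub>E UNIV"
  from assms have "\<exists>r>0. \<exists>c. \<forall>x\<in>ball a r. ((\<lambda>\<alpha>. e x \<alpha> *\<^sub>R c \<alpha>) has_sum f x) J"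
    unfolding real_analytic_on_def e_def J_def by (rule bspec)
  then obtain r c where r: "r > 0"
    and sum: "\<And>x. x \<in> ball a r \<Longrightarrow> ((\<lambda>\<alpha>. e x \<alpha> *\<^sub>R c \<alpha>) has_sum f x) J"
    by blast
  \<comment> \<open>Half the side of the cube \<open>Q\<close>. Its points have l1 distance at most
    \<open>DIM('a) * s = r / 2\<close> from \<open>a\<close>, so \<open>Q\<close> lies in the ball
    of convergence.\<close>
  define s where "s = r / (2 * real DIM('a))"
  have s: "s > 0"
    using r by (simp add: s_def)
  define Q where "Q = cbox (a - s *\<^sub>R One) (a + s *\<^sub>R One)"
  have Q_iff: "x \<in> Q \<longleftrightarrow> (\<forall>b\<in>Basis. \<bar>(x - a) \<bullet> b\<bar> \<le> s)" for x
    by (auto simp: Q_def mem_box inner_diff_left inner_add_left abs_le_iff algebra_simps)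
  have Q_ball: "x \<in> ball a r" if "x \<in> Q" for x
  proof -
    have "norm (x - a) \<le> (\<Sum>b\<in>Basis. \<bar>(x - a) \<bullet> b\<bar>)"
      by (rule norm_le_l1)
    also have "\<dots> \<le> real DIM('a) * s"
      using that by (intro sum_bounded_above) (simp add: Q_iff)
    also have "\<dots> < r"
      using r by (simp add: s_def)
    finally show ?thesis
      by (simp add: dist_norm norm_minus_commute)
  qed
  \<comment> \<open>At this corner every coordinate of the displacement from \<open>a\<close> equals
    \<open>s\<close>, so each monomial attains there its largest absolute value over
    \<open>Q\<close>.\<close>
  have "a + s *\<^sub>R One \<in> Q"
    using s by (simp add: Q_iff)
  then have "(\<lambda>\<alpha>. e (a + s *\<^sub>R One) \<alpha> *\<^sub>R c \<alpha>) summable_on J"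
    using sum[OF Q_ball] by (auto simp: summable_on_def)
  then have summable: "(\<lambda>\<alpha>. norm (e (a + s *\<^sub>R One) \<alpha> *\<^sub>R c \<alpha>)) summable_on J"
    by (rule summable_on_imp_abs_summable_on_euclidean)
  have dominated: "norm (e x \<alpha> *\<^sub>R c \<alpha>) \<le> norm (e (a + s *\<^sub>R One) \<alpha> *\<^sub>R c \<alpha>)" if "x \<in> Q" for x \<alpha>
  proof -
    have "\<bar>e x \<alpha>\<bar> \<le> \<bar>e (a + s *\<^sub>R One) \<alpha>\<bar>"
      using that s unfolding e_def abs_prod
      by (intro prod_mono) (auto simp: power_abs Q_iff intro!: power_mono)
    then show ?thesis
      by (simp add: mult_right_mono)
  qed
  have "continuous_on Q f"
  proof (rule uniform_limit_theorem)
    show "uniform_limit Q (\<lambda>F x. \<Sum>\<alpha>\<in>F. e x \<alpha> *\<^sub>R c \<alpha>) f (finite_subsets_at_top J)"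
      by (rule Weierstrass_m_test_general'[OF dominated _ summable]) (auto intro: sum Q_ball)
    show "\<forall>\<^sub>F F in finite_subsets_at_top J. continuous_on Q (\<lambda>x. \<Sum>\<alpha>\<in>F. e x \<alpha> *\<^sub>R c \<alpha>)"
      unfolding e_def by (intro always_eventually allI continuous_intros)
  qed simp
  \<comment> \<open>Being interior turns continuity relative to \<open>Q\<close> into continuity at
    \<open>a\<close> with respect to the whole space.\<close>
  moreover have "a \<in> interior Q"
    using s by (simp add: Q_def mem_box inner_diff_left inner_add_left)
  ultimately show ?thesis
    by (rule continuous_on_interior)
qed

lemma real_analytic_on_imp_continuous_on:
  "real_analytic_on f S \<Longrightarrow> continuous_on S f"
  using real_analytic_on_imp_continuous_at by (blast intro: continuous_at_imp_continuous_on)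

text \<open>This is the case of a family with one member, the segment between two nearby points; it
  lies in \<open>S\<close> because \<open>S\<close> is an interval.\<close>

lemma abs_continuous_on_imp_continuous_on:
  assumes "is_interval S" "abs_continuous_on S f"
  shows "continuous_on S f"
  unfolding continuous_on_iff
proof (intro ballI allI impI)
  fix s and \<epsilon> :: real
  assume s: "s \<in> S" and "\<epsilon> > 0"
  from assms(2)[unfolded abs_continuous_on_def, rule_format, OF this(2)]
  obtain \<delta> where "\<delta> > 0" and \<delta>: "\<forall>(N::nat) a b.
      (\<forall>i<N. a i \<le> b i \<and> {a i..b i} \<subseteq> S) \<longrightarrow>
      (\<forall>i<N. \<forall>j<N. i \<noteq> j \<longrightarrow> {a i<..<b i} \<inter> {a j<..<b j} = {}) \<longrightarrow>
      (\<Sum>i<N. b i - a i) < \<delta> \<longrightarrow> (\<Sum>i<N. norm (f (b i) - f (a i))) < \<epsilon>"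
    by (elim exE conjE) (rule that)
  have single: "norm (f b - f a) < \<epsilon>" if "a \<le> b" "a \<in> S" "b \<in> S" "b - a < \<delta>" for a b
  proof -
    have "{a..b} \<subseteq> S"
      using assms(1) that unfolding is_interval_1 by (meson atLeastAtMost_iff subsetI)
    then show ?thesis
      using \<delta>[rule_format, of "Suc 0" "\<lambda>_. a" "\<lambda>_. b"] that by simp
  qed
  have "dist (f t) (f s) < \<epsilon>" if "t \<in> S" "dist t s < \<delta>" for t
  proof (cases "s \<le> t")
    case True
    then show ?thesis
      using single[of s t] s that by (simp add: dist_norm dist_real_def)
  next
    case False
    then show ?thesis
      using single[of t s] s that by (simp add: dist_norm dist_real_def norm_minus_commute)
  qed
  with \<open>\<delta> > 0\<close> show "\<exists>\<delta>>0. \<forall>t\<in>S. dist t s < \<delta> \<longrightarrow> dist (f t) (f s) < \<epsilon>"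
    by blast
qed

text \<open>The sublevel set of \<open>h\<close> is closed and has full measure in the open
  interval. A closed set missing a point of an open set misses a set of positive measure, so it
  contains the open interval. The endpoints follow by continuity, since \<open>a < b\<close> makes
  them limits of interior points.\<close>

lemma AE_lebesgue_on_le_imp_le:
  fixes h :: "real \<Rightarrow> real"
  assumes "a < b" "continuous_on {a..b} h"
    and ae: "AE t in lebesgue_on {a..b}. h t \<le> c"
    and t: "t \<in> {a..b}"
  shows "h t \<le> c"
proof (rule continuous_le_on_closure[of "{a<..<b}" h t c])
  show "continuous_on (closure {a<..<b}) h" "t \<in> closure {a<..<b}"
    using assms by simp_all
next
  let ?C = "{s \<in> {a..b}. h s \<le> c}"
  fix s assume s: "s \<in> {a<..<b}"
  have "closed ?C"
    using assms(2) by (intro continuous_on_closed_Collect_le) auto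
  moreover from ae have "AE s in lebesgue. s \<in> {a..b} \<longrightarrow> h s \<le> c"
    by (simp add: AE_restrict_space_iff)
  then have "AE s\<in>{a<..<b} in lebesgue. s \<in> ?C"
    by eventually_elim simp
  ultimately have "s \<in> ?C"
    using s by (rule mem_closed_if_AE_lebesgue_open[OF open_greaterThanLessThan])
  then show "h s \<le> c"
    by simp
qed

theorem lemma5p1:
  fixes P :: "('n::finite, 'm::finite) affine_problem"
    and T lam :: real
    and x p :: "real \<Rightarrow> real^'n"
    and u :: "real \<Rightarrow> real^'m"
    and x0 :: "real \<Rightarrow> real"
    and I :: "real set"
  assumes "analytic_problem P"
    and "optimal_trajectory P T x u"
    and "pmp_lift P T x u lam p"
    and "cost_coordinate P T x u x0"
    and "singular_arc P T (aug_state x0 x) (aug_costate lam p) I"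
  shows "\<forall>t\<in>I. aug_costate lam p t \<bullet> aug_drift P (aug_state x0 x t) = 0"
proof
  define \<phi> where "\<phi> = (\<lambda>t. aug_costate lam p t \<bullet> aug_drift P (aug_state x0 x t))"
  define \<psi> where "\<psi> = (\<lambda>i t. aug_costate lam p t \<bullet> aug_ctrl P i (aug_state x0 x t))"
  \<comment> \<open>The control \<open>u\<close> is only measurable. Bounding it by
    \<open>bnd P\<close> removes it from the estimate, so that \<open>h\<close> is
    continuous.\<close>
  define h where "h = (\<lambda>t. \<bar>\<phi> t\<bar> - bnd P t * (\<Sum>i\<in>UNIV. \<bar>\<psi> i t\<bar>))"
  have T: "T > 0" and x: "continuous_on {0..T} x"
    using assms(2) by (auto simp: optimal_trajectory_def admissible_trajectory_def
        intro: abs_continuous_on_imp_continuous_on is_interval_cc)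
  have p: "continuous_on {0..T} p"
    using assms(3) by (auto simp: pmp_lift_def
        intro: abs_continuous_on_imp_continuous_on is_interval_cc)
  have along: "continuous_on {0..T} (\<lambda>t. F (x t))" if "real_analytic_on F UNIV"
    for F :: "real^'n \<Rightarrow> 'c::euclidean_space"
    using continuous_on_compose2[OF real_analytic_on_imp_continuous_on[OF that] x] by simp
  \<comment> \<open>The augmented fields read only the \<open>snd\<close> component of the state, so
    both of their components are analytic functions evaluated along \<open>x\<close>.\<close>
  have "continuous_on {0..T} (\<lambda>t. aug_drift P (aug_state x0 x t))"
    "continuous_on {0..T} (\<lambda>t. aug_ctrl P i (aug_state x0 x t))" for i
    using assms(1) unfolding analytic_problem_def aug_drift_def aug_ctrl_def aug_state_def snd_conv
    by (intro continuous_on_Pair along; simp)+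
  moreover have "continuous_on {0..T} (aug_costate lam p)"
    unfolding aug_costate_def by (intro continuous_intros p)
  ultimately have "continuous_on {0..T} \<phi>" "continuous_on {0..T} (\<psi> i)" for i
    unfolding \<phi>_def \<psi>_def by (intro continuous_intros; simp)+
  moreover have "continuous_on {0..T} (bnd P)"
    using assms(1) unfolding analytic_problem_def
    by (intro continuous_on_subset[OF real_analytic_on_imp_continuous_on[of _ "{0..}"]]) auto
  ultimately have h: "continuous_on {0..T} h"
    unfolding h_def by (intro continuous_intros)
  have le: "h t \<le> 0"
    if zero: "hamiltonian P lam (x t) (p t) (u t) = 0" and ctl: "control_value P t (u t)" for t
  proof -
    \<comment> \<open>The zero Hamiltonian makes \<phi> the negative of the control sum. The cost
      coordinate \<open>x0\<close> is fixed explicitly because the Hamiltonian does not determine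
      it.\<close>
    have "\<bar>\<phi> t\<bar> = \<bar>\<Sum>i\<in>UNIV. \<psi> i t * u t $ i\<bar>"
      using zero by (simp add: hamiltonian_augmented[where ?x0.0 = x0] \<phi>_def \<psi>_def)
    also have "\<dots> \<le> (\<Sum>i\<in>UNIV. \<bar>\<psi> i t * u t $ i\<bar>)"
      by (rule sum_abs)
    also have "\<dots> \<le> (\<Sum>i\<in>UNIV. bnd P t * \<bar>\<psi> i t\<bar>)"
      using ctl by (intro sum_mono)
        (simp add: control_value_def abs_mult mult.commute[of "bnd P t"] mult_left_mono)
    finally show ?thesis
      by (simp add: h_def sum_distrib_left)
  qed
  \<comment> \<open>The control bound is read off the maximum condition: a maximizer over
    \<open>control_value P t\<close> belongs to that set.\<close>
  have "AE t in lebesgue_on {0..T}. control_value P t (u t)"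
    "AE t in lebesgue_on {0..T}. hamiltonian P lam (x t) (p t) (u t) = 0"
    using assms(3) by (auto simp: pmp_lift_def is_arg_max_def)
  then have ae: "AE t in lebesgue_on {0..T}. h t \<le> 0"
    by eventually_elim (rule le)
  fix t assume "t \<in> I"
  with assms(5) have t: "t \<in> {0..T}" and zero: "\<And>i. \<psi> i t = 0"
    by (auto simp: singular_arc_def \<psi>_def)
  \<comment> \<open>The time \<open>t\<close> may lie in the exceptional null set; the passage from
    almost every to every time covers it.\<close>
  from AE_lebesgue_on_le_imp_le[OF T h ae t] have "\<bar>\<phi> t\<bar> \<le> 0"
    by (simp add: h_def zero)
  then show "aug_costate lam p t \<bullet> aug_drift P (aug_state x0 x t) = 0"
    by (simp add: \<phi>_def)
qed

end
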